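(* Let $p_0=2$ and, for $i\ge 1$, let $p_i$ be the $i$-th odd prime (so $p_1=3$, $p_2=5$, $p_3=7,\dots$). For a positive integer $n$ put $Q_n=(p_0-1)(p_1-1)\cdots(p_n-1)$ and $M_n=\{p_0,p_1,\dots,p_n\}$. Then for every positive integer $n$ there exist pairwise distinct positive integers $x_1,x_2,\dots,x_{n+2}$ such that $$\varphi(x_1)=\varphi(x_2)=\dots=\varphi(x_{n+2})=Q_n,$$ every prime divisor of each $x_i$ belongs to $M_n$, and $x_{n+2}=p_0p_1\cdots p_n$.
   Context: $\varphi$ denotes Euler's totient function. *)

theory Defs
  imports "HOL-Number_Theory.Number_Theory" "HOL-Library.Infinite_Set"
begin

text \<open>The value at \<open>Suc i\<close> is the \<open>(i + 1)\<close>-st odd prime, since \<^const>\<open>enumerate\<close> lists an infinite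
  set of naturals in increasing order starting at index 0.\<close>

fun p_seq :: "nat \<Rightarrow> nat" where
  "p_seq 0 = 2"
| "p_seq (Suc i) = enumerate {q. prime q \<and> odd q} i"

text \<open>The subtraction does not truncate, as every \<^term>\<open>p_seq i\<close> is a prime.\<close>

definition Q_prod :: "nat \<Rightarrow> nat" where
  "Q_prod n = (\<Prod>i\<le>n. (p_seq i - 1))"

definition M_set :: "nat \<Rightarrow> nat set" where
  "M_set n = p_seq ` {..n}"

end

theory Submission
  imports Defs
begin

text \<open>Put \<open>P = p\<^sub>0 \<cdots> p\<^sub>n\<close>. All primes dividing \<open>p\<^sub>i - 1\<close> are among \<open>p\<^sub>0, \<dots>, p\<^bsub>i-1\<^esub>\<close>, so multiplying
  \<open>P / p\<^sub>i\<close> by \<open>p\<^sub>i - 1\<close> multiplies its totient by \<open>p\<^sub>i - 1\<close>. Thus the \<open>n + 1\<close> numbers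
  \<open>(p\<^sub>i - 1) P / p\<^sub>i\<close> have the same totient as \<open>P\<close>; the \<open>i\<close>-th one is the only one among them
  that is not divisible by \<open>p\<^sub>i\<close>.\<close>

lemma infinite_odd_primes: "infinite {q::nat. prime q \<and> odd q}"
proof -
  have "{q::nat. prime q} \<subseteq> insert 2 {q. prime q \<and> odd q}"
    using primes_dvd_imp_eq[OF two_is_prime_nat] by auto
  then show ?thesis
    using primes_infinite finite_subset by blast
qed

lemma p_seq_Suc_mem: "prime (p_seq (Suc i)) \<and> odd (p_seq (Suc i))"
  using enumerate_in_set[OF infinite_odd_primes, of i] by simp

lemma prime_p_seq: "prime (p_seq i)"
  using p_seq_Suc_mem by (cases i) auto

lemma strict_mono_p_seq: "strict_mono p_seq"
  unfolding strict_mono_Suc_iff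
proof
  fix i
  show "p_seq i < p_seq (Suc i)"
  proof (cases i)
    case 0
    have "p_seq (Suc 0) \<noteq> 2"
      using p_seq_Suc_mem[of 0] by (metis even_numeral)
    moreover have "p_seq (Suc 0) \<ge> 2"
      using p_seq_Suc_mem[of 0] prime_ge_2_nat by blast
    ultimately show ?thesis using 0 by simp
  next
    case (Suc j)
    then show ?thesis
      using enumerate_step[OF infinite_odd_primes, of j] by simp
  qed
qed

lemma prime_eq_p_seq:
  assumes "prime q"
  obtains j where "q = p_seq j"
proof (cases "even q")
  case True
  with assms have "q = p_seq 0"
    using primes_dvd_imp_eq[OF two_is_prime_nat] by simp
  then show ?thesis using that by blast
next
  case False
  with assms obtain j where "enumerate {q. prime q \<and> odd q} j = q"
    using enumerate_Ex[OF infinite_odd_primes, of q] by auto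
  then show ?thesis using that[of "Suc j"] by simp
qed

text \<open>In Euler's formula \<open>totient n\<close> is \<open>n\<close> times a product
  depending only on the set of primes dividing \<open>n\<close>. The hypothesis makes this set the
  same for \<open>a * m\<close> and \<open>m\<close>, so only the leading factor changes.\<close>

lemma totient_mult_of_prime_factors_dvd:
  fixes a m :: nat
  assumes "a > 0" and "m > 0" and "\<And>q. prime q \<Longrightarrow> q dvd a \<Longrightarrow> q dvd m"
  shows "totient (a * m) = a * totient m"
proof -
  have "prime_factors (a * m) = prime_factors m"
    using assms by (auto simp: prime_factors_dvd prime_dvd_mult_iff)
  then have "real (totient (a * m)) = real (a * totient m)"
    by (simp only: totient_formula2 of_nat_mult mult.assoc)
  then show ?thesis by linarith
qed

lemma p_seq_dvd_prod_p_seq_iff: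
  assumes "finite A"
  shows "p_seq i dvd (\<Prod>j\<in>A. p_seq j) \<longleftrightarrow> i \<in> A"
proof -
  have "p_seq i dvd p_seq j \<longleftrightarrow> i = j" for j
    using primes_dvd_imp_eq[OF prime_p_seq prime_p_seq]
      strict_mono_eq[OF strict_mono_p_seq] by auto
  then show ?thesis
    using assms by (auto simp: prime_dvd_prod_iff prime_p_seq)
qed

lemma totient_prod_p_seq: "totient (\<Prod>j\<in>A. p_seq j) = (\<Prod>j\<in>A. p_seq j - 1)"
proof -
  have "pairwise coprime (p_seq ` A)"
    by (auto simp: pairwise_def intro!: primes_coprime prime_p_seq)
  moreover have "inj_on p_seq A"
    using strict_mono_p_seq by (simp add: strict_mono_imp_inj_on inj_on_subset[of _ UNIV])
  ultimately show ?thesis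
    by (simp add: totient_prod_coprime totient_prime prime_p_seq)
qed

text \<open>This is the number \<open>(p_i - 1) P / p_i\<close> of the overview. Leaving out the
  index \<open>i\<close> replaces the division.\<close>

definition swapped_prod :: "nat \<Rightarrow> nat \<Rightarrow> nat" where
  "swapped_prod n i = (p_seq i - 1) * (\<Prod>j\<in>{..n} - {i}. p_seq j)"

lemma prime_dvd_p_seq_minus_1:
  assumes "prime q" and "q dvd p_seq i - 1"
  obtains j where "j < i" and "q = p_seq j"
proof -
  obtain j where j: "q = p_seq j"
    using prime_eq_p_seq[OF assms(1)] .
  \<comment> \<open>This makes \<open>p_seq i - 1\<close> positive, so that its divisor
    \<open>q\<close> is at most \<open>p_seq i - 1\<close>; every number divides 0.\<close>
  have "p_seq i > 1"
    using prime_p_seq prime_gt_1_nat by blast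
  then have "p_seq j < p_seq i"
    using dvd_imp_le[OF assms(2)] j by linarith
  then show ?thesis
    using that j strict_mono_less[OF strict_mono_p_seq] by blast
qed

text \<open>The factor \<open>p_seq i - 1\<close> brings in no new primes: its prime divisors are
  earlier terms of the sequence, hence already factors of the remaining product.\<close>

lemma prime_dvd_swapped_prod:
  assumes "prime q" and "i \<le> n" and "q dvd swapped_prod n i"
  shows "q dvd (\<Prod>j\<in>{..n} - {i}. p_seq j)"
proof (cases "q dvd p_seq i - 1")
  case True
  then obtain j where "j < i" "q = p_seq j"
    using prime_dvd_p_seq_minus_1[OF assms(1)] by blast
  then show ?thesis
    using assms(2) by (simp add: p_seq_dvd_prod_p_seq_iff)
next
  case False
  then show ?thesis
    using assms by (simp add: swapped_prod_def prime_dvd_mult_iff)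
qed

lemma p_seq_dvd_swapped_prod_iff:
  assumes "i \<le> n" and "k \<le> n"
  shows "p_seq k dvd swapped_prod n i \<longleftrightarrow> k \<noteq> i"
proof
  assume "p_seq k dvd swapped_prod n i"
  then show "k \<noteq> i"
    using prime_dvd_swapped_prod[OF prime_p_seq assms(1)]
    by (auto simp: p_seq_dvd_prod_p_seq_iff)
next
  assume "k \<noteq> i"
  then show "p_seq k dvd swapped_prod n i"
    using assms by (simp add: swapped_prod_def p_seq_dvd_prod_p_seq_iff)
qed

lemma p_seq_pos: "p_seq i > 0"
  using prime_p_seq prime_gt_0_nat by blast

lemma swapped_prod_pos: "swapped_prod n i > 0"
proof -
  have "p_seq i > 1"
    using prime_p_seq prime_gt_1_nat by blast
  then show ?thesis
    by (simp add: swapped_prod_def prod_pos p_seq_pos)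
qed

lemma totient_swapped_prod:
  assumes "i \<le> n"
  shows "totient (swapped_prod n i) = Q_prod n"
proof -
  have "totient (swapped_prod n i) = (p_seq i - 1) * totient (\<Prod>j\<in>{..n} - {i}. p_seq j)"
    unfolding swapped_prod_def
  proof (rule totient_mult_of_prime_factors_dvd)
    show "p_seq i - 1 > 0" "(\<Prod>j\<in>{..n} - {i}. p_seq j) > 0"
      using swapped_prod_pos[of n i] by (simp_all add: swapped_prod_def)
  next
    fix q assume "prime q" "q dvd p_seq i - 1"
    then show "q dvd (\<Prod>j\<in>{..n} - {i}. p_seq j)"
      using assms prime_dvd_swapped_prod by (simp add: swapped_prod_def)
  qed
  also have "\<dots> = (p_seq i - 1) * (\<Prod>j\<in>{..n} - {i}. p_seq j - 1)"
    by (simp add: totient_prod_p_seq)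
  also have "\<dots> = Q_prod n"
    using assms unfolding Q_prod_def by (subst prod.remove[of "{..n}" i]) auto
  finally show ?thesis .
qed

theorem theorem5:
  fixes n :: nat
  assumes "n \<ge> 1"
  shows "\<exists>x :: nat \<Rightarrow> nat.
           inj_on x {1..n + 2}
         \<and> (\<forall>i\<in>{1..n + 2}. x i > 0)
         \<and> (\<forall>i\<in>{1..n + 2}. totient (x i) = Q_prod n)
         \<and> (\<forall>i\<in>{1..n + 2}. \<forall>q. prime q \<and> q dvd x i \<longrightarrow> q \<in> M_set n)
         \<and> x (n + 2) = (\<Prod>i\<le>n. p_seq i)"
proof -
  define P where "P = (\<Prod>i\<le>n. p_seq i)"
  \<comment> \<open>The indices 1 to \<open>n + 1\<close> carry the swapped products for 0 to
    \<open>n\<close>, hence the shift by one; the last index carries \<open>P\<close>.\<close>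
  define x where "x k = (if k = n + 2 then P else swapped_prod n (k - 1))" for k
  have cases: "k = n + 2 \<and> x k = P \<or> k - 1 \<le> n \<and> x k = swapped_prod n (k - 1)"
    if "k \<in> {1..n + 2}" for k
    using that by (auto simp: x_def)
  \<comment> \<open>For \<open>k = n + 2\<close> the index \<open>k - 1 = n + 1\<close> exceeds
    every \<open>j\<close> considered, so the same formula also says that all these primes divide
    \<open>P\<close>.\<close>
  have dvd_iff: "p_seq j dvd x k \<longleftrightarrow> j \<noteq> k - 1" if "k \<in> {1..n + 2}" "j \<le> n" for j k
    using cases[OF that(1)] that(2)
    by (auto simp: P_def p_seq_dvd_prod_p_seq_iff p_seq_dvd_swapped_prod_iff)
  have "inj_on x {1..n + 2}"
  proof (rule linorder_inj_onI')
    fix k l assume kl: "k \<in> {1..n + 2}" "l \<in> {1..n + 2}" "k < l"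
    \<comment> \<open>From \<open>k < l\<close> it follows that \<open>k \<le> n + 1\<close>, so
      \<open>x k\<close> is a swapped product and the prime missing from it separates it from
      \<open>x l\<close>, even when \<open>x l\<close> is \<open>P\<close>.\<close>
    then have "\<not> p_seq (k - 1) dvd x k" "p_seq (k - 1) dvd x l"
      using dvd_iff[of k "k - 1"] dvd_iff[of l "k - 1"] by auto
    then show "x k \<noteq> x l" by metis
  qed
  moreover have "x k > 0" if "k \<in> {1..n + 2}" for k
    using cases[OF that] by (auto simp: P_def swapped_prod_pos p_seq_pos prod_pos)
  moreover have "totient (x k) = Q_prod n" if "k \<in> {1..n + 2}" for k
    using cases[OF that]
    by (auto simp: P_def totient_swapped_prod totient_prod_p_seq Q_prod_def)
  moreover have "q \<in> M_set n" if k: "k \<in> {1..n + 2}" and q: "prime q" "q dvd x k" for k q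
  proof -
    obtain j where j: "q = p_seq j"
      using prime_eq_p_seq[OF q(1)] .
    have "q dvd P \<or> k - 1 \<le> n \<and> q dvd (\<Prod>j\<in>{..n} - {k - 1}. p_seq j)"
      using cases[OF k] q prime_dvd_swapped_prod by metis
    then have "j \<le> n"
      by (auto simp: j P_def p_seq_dvd_prod_p_seq_iff)
    then show ?thesis by (simp add: j M_set_def)
  qed
  moreover have "x (n + 2) = (\<Prod>i\<le>n. p_seq i)"
    by (simp add: x_def P_def)
  ultimately show ?thesis by blast
qed

end
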